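(* Every L-module $M\subset\mathbb{C}[x,y]$ of order $1$ is indecomposable.
   Context: A submodule (or module) of $\mathbb{C}[x,y]$ is a translation invariant linear subspace of $\mathbb{C}[x,y]$; equivalently, a linear subspace closed under the partial derivatives $\partial/\partial x$ and $\partial/\partial y$. Every $F\in \mathbb{C}[x,y]$ can be written uniquely as $F(x,y)=\sum_{n=0}^\infty f_n(x)\frac{y^n}{n!}$ with $f_n\in \mathbb{C}[x]$ and $f_n=0$ for all large $n$; the coordinate polynomials of $F$ are $[F]_n=f_n$. For a positive integer $s$, a set $M\subset\mathbb{C}[x,y]$ is an L-module of order $s$ if $M$ is a module and, whenever $F\in M$ and $[F]_n=0$ for every $n<s$, then $F=0$. The sum of sets of polynomials is $A+B=\{f+g\colon f\in A, g\in B\}$. A submodule $M$ is decomposable if $M=A_1+\cdots+A_k$ for some $k\ge 1$ and some proper submodules $A_1,\ldots,A_k$ of $M$ (submodules of $\mathbb{C}[x,y]$ contained in $M$ and different from $M$). Otherwise $M$ is indecomposable. *)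

theory Defs
  imports Complex_Main "HOL-Computational_Algebra.Polynomial" "HOL-Library.Set_Algebras"
begin

text \<open>
  The ring of bivariate complex polynomials is represented by \<^typ>\<open>complex poly poly\<close>:
  the outer variable is \<open>y\<close>, and the coefficients are polynomials in \<open>x\<close>. Thus the value of
  \<open>F\<close> at \<open>(u, v)\<close> is \<open>poly (poly F [:v:]) u\<close>.
\<close>

global_interpretation xy: vector_space "\<lambda>(c::complex) (F::complex poly poly). smult [:c:] F"
  by unfold_locales
    (simp_all add: smult_add_right mult.commute flip: smult_add_left one_pCons)

text \<open>\<open>F(x + a, y + b)\<close>: first substitute in every coefficient, then in the outer variable.\<close>

definition translate :: "complex \<Rightarrow> complex \<Rightarrow> complex poly poly \<Rightarrow> complex poly poly" where
  "translate a b F = pcompose (map_poly (\<lambda>f. pcompose f [:a, 1:]) F) [:[:b:], 1:]"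

lemma poly_translate:
  "poly (poly (translate a b F) [:v:]) u = poly (poly F [:v + b:]) (u + a)"
  by (induction F)
    (simp_all add: translate_def map_poly_pCons pcompose_pCons poly_pcompose algebra_simps)

definition xy_module :: "complex poly poly set \<Rightarrow> bool" where
  "xy_module M \<longleftrightarrow> xy.subspace M \<and> (\<forall>a b. \<forall>F\<in>M. translate a b F \<in> M)"

text \<open>The factorial comes from expanding in \<open>y\<^sup>n / n!\<close> instead of \<open>y\<^sup>n\<close>.\<close>

definition coord :: "complex poly poly \<Rightarrow> nat \<Rightarrow> complex poly" where
  "coord F n = smult (fact n) (coeff F n)"

lemma coord_expansion:
  "F = (\<Sum>n\<le>degree F. monom (smult (1 / fact n) (coord F n)) n)"
  by (simp add: coord_def poly_as_sum_of_monoms)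

lemma coord_unique:
  assumes "F = (\<Sum>n\<le>N. monom (smult (1 / fact n) (f n)) n)" and "\<And>n. n > N \<Longrightarrow> f n = 0"
  shows "coord F = f"
proof
  fix n
  show "coord F n = f n"
    using assms(2)[of n] by (cases "n \<le> N") (simp_all add: assms(1) coord_def coeff_sum if_distrib)
qed

definition L_module :: "nat \<Rightarrow> complex poly poly set \<Rightarrow> bool" where
  "L_module s M \<longleftrightarrow> 0 < s \<and> xy_module M \<and> (\<forall>F\<in>M. (\<forall>n<s. coord F n = 0) \<longrightarrow> F = 0)"

text \<open>
  The sum over \<open>i\<close> below is the iterated elementwise sum of sets from
  \<^theory>\<open>HOL-Library.Set_Algebras\<close>; it need not be direct.
\<close>

definition decomposable :: "complex poly poly set \<Rightarrow> bool" where
  "decomposable M \<longleftrightarrow> xy_module M \<and>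
     (\<exists>k\<ge>1. \<exists>A :: nat \<Rightarrow> complex poly poly set.
        (\<forall>i\<in>{1..k}. xy_module (A i) \<and> A i \<subset> M) \<and> M = (\<Sum>i=1..k. A i))"

definition indecomposable :: "complex poly poly set \<Rightarrow> bool" where
  "indecomposable M \<longleftrightarrow> xy_module M \<and> \<not> decomposable M"

end

theory Submission
  imports Defs
begin

text \<open>
  The submodules of an L-module \<open>M\<close> of order 1 form a chain, so a finite sum of proper ones is
  their largest member and cannot exhaust \<open>M\<close>.

  The reason is that \<open>F \<mapsto> coord F 0\<close> is linear and injective on \<open>M\<close> and commutes with translations
  in \<open>x\<close>. It therefore embeds the submodules of \<open>M\<close> into the translation invariant subspaces of
  \<open>\<complex>[x]\<close>, and such a subspace contains, along with \<open>g \<noteq> 0\<close>, every polynomial of degree at most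
  \<open>degree g\<close> (lemma \<open>shift_invariant_downward_closed\<close>). Consequently, if \<open>F \<in> M\<close> lies outside a
  submodule \<open>A\<close>, all coordinates \<open>coord G 0\<close> of elements \<open>G \<in> A\<close> have degree below that of
  \<open>coord F 0\<close> (lemma \<open>submodule_coord_degree_bound\<close>).

  Rather than building the chain, the proof of the theorem uses this bound directly. Given proper
  submodules \<open>A\<^sub>1, \<dots>, A\<^sub>k\<close>, choose a witness of \<open>M \<noteq> A\<^sub>i\<close> for every \<open>i\<close>, and let \<open>F\<close> be one for
  which \<open>coord F 0\<close> has maximal degree. No coordinate of an element of \<open>A\<^sub>1 + \<dots> + A\<^sub>k\<close> reaches
  this degree, so \<open>F\<close> is not in the sum.
\<close>

text \<open>The forward difference behaves like the derivative on the leading term.\<close>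

lemma coeff_forward_difference:
  fixes g :: "'a::idom poly"
  assumes "degree g = Suc n"
  shows "coeff (pcompose g [:1, 1:] - g) n = of_nat (Suc n) * lead_coeff g"
  using assms
proof (induction n arbitrary: g)
  case 0
  obtain a p where g: "g = pCons a p" by (cases g)
  with 0 have "degree p = 0" "p \<noteq> 0" by (auto split: if_splits)
  then obtain c where "p = [:c:]" by (auto elim: degree_eq_zeroE)
  with \<open>p \<noteq> 0\<close> show ?case by (simp add: g pcompose_pCons)
next
  case (Suc n)
  obtain a p where g: "g = pCons a p" by (cases g)
  with Suc.prems have p: "degree p = Suc n" by (auto split: if_splits)
  then have "p \<noteq> 0" by auto
  have lead: "coeff (pcompose p [:1, 1:]) (Suc n) = lead_coeff p"
    using lead_coeff_comp[of "[:1, 1:]" p] by (simp add: p degree_pcompose)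
  have "pcompose g [:1, 1:] - g
      = pcompose p [:1, 1:] + pCons 0 (pcompose p [:1, 1:] - p)"
    by (simp add: g pcompose_pCons)
  then have "coeff (pcompose g [:1, 1:] - g) (Suc n)
      = lead_coeff p + of_nat (Suc n) * lead_coeff p"
    using Suc.IH[OF p] lead by simp
  then show ?case using \<open>p \<noteq> 0\<close> by (simp add: g algebra_simps)
qed

lemma degree_forward_difference_le:
  fixes g :: "'a::idom poly"
  assumes "degree g = Suc n"
  shows "degree (pcompose g [:1, 1:] - g) \<le> n"
proof (rule degree_le, intro allI impI)
  fix i
  assume "n < i"
  show "coeff (pcompose g [:1, 1:] - g) i = 0"
  proof (cases "i = Suc n")
    case True
    then show ?thesis using lead_coeff_comp[of "[:1, 1:]" g] by (simp add: assms degree_pcompose)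
  next
    case False
    with \<open>n < i\<close> show ?thesis by (simp add: coeff_eq_0 assms degree_pcompose)
  qed
qed

text \<open>
  Differencing \<open>g\<close> repeatedly yields an element of every degree up to \<open>degree g\<close>, and those span.
  Characteristic 0 is what makes the degree drop by exactly one.
\<close>

lemma shift_invariant_downward_closed:
  fixes P :: "'a::field_char_0 poly set"
  assumes diff: "\<And>f g. f \<in> P \<Longrightarrow> g \<in> P \<Longrightarrow> f - g \<in> P"
    and add: "\<And>f g. f \<in> P \<Longrightarrow> g \<in> P \<Longrightarrow> f + g \<in> P"
    and scale: "\<And>c f. f \<in> P \<Longrightarrow> smult c f \<in> P"
    and shift: "\<And>f. f \<in> P \<Longrightarrow> pcompose f [:1, 1:] \<in> P"
    and "g \<in> P" "g \<noteq> 0" "degree f \<le> degree g"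
  shows "f \<in> P"
  using assms(5-)
proof (induction "degree g" arbitrary: f g)
  case 0
  then have "degree f = 0" "degree g = 0" by simp_all
  then obtain b c where "f = [:b:]" "g = [:c:]" by (elim degree_eq_zeroE)
  with \<open>g \<noteq> 0\<close> have "f = smult (b / c) g" by simp
  then show ?case using scale[OF \<open>g \<in> P\<close>, of "b / c"] by simp
next
  case (Suc n)
  define h where "h = pcompose g [:1, 1:] - g"
  have deg: "degree g = Suc n" using Suc.hyps(2) by simp
  have lead: "coeff h n = of_nat (Suc n) * lead_coeff g"
    unfolding h_def by (rule coeff_forward_difference[OF deg])
  then have "coeff h n \<noteq> 0" using \<open>g \<noteq> 0\<close> by (simp del: of_nat_Suc)
  then have "h \<noteq> 0" "n \<le> degree h" by (auto intro: le_degree)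
  moreover have "degree h \<le> n"
    unfolding h_def by (rule degree_forward_difference_le[OF deg])
  ultimately have h: "h \<in> P" "h \<noteq> 0" "n = degree h"
    using diff[OF shift] \<open>g \<in> P\<close> by (auto simp: h_def)
  \<comment> \<open>Cancelling the top coefficient of \<open>f\<close> against \<open>g\<close> brings it within reach of \<open>h\<close>.\<close>
  define c where "c = coeff f (Suc n) / lead_coeff g"
  have "degree (f - smult c g) \<le> n"
  proof (rule degree_le, intro allI impI)
    fix i
    assume "n < i"
    show "coeff (f - smult c g) i = 0"
    proof (cases "i = Suc n")
      case True
      then show ?thesis using \<open>g \<noteq> 0\<close> unfolding c_def by (simp flip: deg)
    next
      case False
      with \<open>n < i\<close> show ?thesis using Suc.prems(3) by (simp add: coeff_eq_0 deg)
    qed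
  qed
  then have "f - smult c g \<in> P" using Suc.hyps(1)[OF h(3,1,2)] h(3) by simp
  from add[OF this scale[OF \<open>g \<in> P\<close>, of c]] show ?case by simp
qed

lemma coord_0_translate_x: "coord (translate a 0 F) 0 = pcompose (coord F 0) [:a, 1:]"
  by (simp add: coord_def translate_def coeff_map_poly)

lemma coord_diff: "coord (F - G) n = coord F n - coord G n"
  by (simp add: coord_def smult_diff_right)

lemma coord_add: "coord (F + G) n = coord F n + coord G n"
  by (simp add: coord_def smult_add_right)

lemma coord_scale: "coord (smult [:c:] F) n = smult c (coord F n)"
  by (simp add: coord_def mult.commute)

text \<open>
  If some \<open>coord G 0\<close> reached the degree of \<open>coord F 0\<close>, then \<open>coord F 0\<close> would be the coordinate
  of an element of \<open>A\<close>, and that element equals \<open>F\<close> by injectivity. Vanishing of coefficients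
  expresses the degree bound in a form that includes \<open>coord G 0 = 0\<close> and passes to sums.
\<close>

lemma submodule_coord_degree_bound:
  assumes M: "L_module 1 M" and A: "xy_module A" "A \<subseteq> M"
    and F: "F \<in> M" "F \<notin> A" and G: "G \<in> A"
    and j: "degree (coord F 0) \<le> j"
  shows "coeff (coord G 0) j = 0"
proof (rule ccontr)
  assume nz: "coeff (coord G 0) j \<noteq> 0"
  define P where "P = (\<lambda>H. coord H 0) ` A"
  have sub: "xy.subspace A" and tr: "\<And>a b H. H \<in> A \<Longrightarrow> translate a b H \<in> A"
    using A(1) by (auto simp: xy_module_def)
  have "coord F 0 \<in> P"
  proof (rule shift_invariant_downward_closed[where g = "coord G 0"])
    show "f - g \<in> P" if "f \<in> P" "g \<in> P" for f g
      using that xy.subspace_diff[OF sub] unfolding P_def by (force simp: coord_diff)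
    show "f + g \<in> P" if "f \<in> P" "g \<in> P" for f g
      using that xy.subspace_add[OF sub] unfolding P_def by (force simp: coord_add)
    show "smult c f \<in> P" if "f \<in> P" for c f
      using that xy.subspace_scale[OF sub] unfolding P_def by (force simp: coord_scale)
    show "pcompose f [:1, 1:] \<in> P" if "f \<in> P" for f
      using that tr unfolding P_def by (force simp flip: coord_0_translate_x)
    show "coord G 0 \<in> P" using G by (simp add: P_def)
    show "coord G 0 \<noteq> 0" using nz by auto
    show "degree (coord F 0) \<le> degree (coord G 0)" using j le_degree[OF nz] by simp
  qed
  then obtain H where H: "H \<in> A" "coord F 0 = coord H 0" by (auto simp: P_def)
  have "xy.subspace M" using M by (simp add: L_module_def xy_module_def)
  then have "F - H \<in> M" using F(1) H(1) A(2) by (blast intro: xy.subspace_diff)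
  moreover have "coord (F - H) 0 = 0" using H(2) by (simp add: coord_diff)
  ultimately have "F - H = 0" using M unfolding L_module_def by (metis less_one)
  with H(1) F(2) show False by simp
qed

theorem theorem22:
  fixes M :: "complex poly poly set"
  assumes "L_module 1 M"
  shows "indecomposable M"
proof -
  have "\<not> decomposable M"
  proof
    assume "decomposable M"
    then obtain k and A :: "nat \<Rightarrow> complex poly poly set"
      where k: "k \<ge> 1" and "\<forall>i\<in>{1..k}. xy_module (A i) \<and> A i \<subset> M"
        and sum: "M = (\<Sum>i=1..k. A i)"
      unfolding decomposable_def by (elim conjE exE) (rule that)
    then have A: "xy_module (A i) \<and> A i \<subset> M" if "i \<in> {1..k}" for i using that by blast
    have "\<exists>F. F \<in> M \<and> F \<notin> A i" if "i \<in> {1..k}" for i using A[OF that] by blast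
    then obtain F where F: "\<And>i. i \<in> {1..k} \<Longrightarrow> F i \<in> M \<and> F i \<notin> A i" by metis
    define d where "d i = degree (coord (F i) 0)" for i
    have "Max (d ` {1..k}) \<in> d ` {1..k}" using k by (intro Max_in) auto
    then obtain m where m: "m \<in> {1..k}" "Max (d ` {1..k}) = d m" by blast
    have max: "d i \<le> d m" if "i \<in> {1..k}" for i
      unfolding m(2)[symmetric] using that by simp
    have "F m \<in> (\<Sum>i=1..k. A i)" using F[OF m(1)] unfolding sum[symmetric] ..
    then have "\<exists>G. F m = (\<Sum>i=1..k. G i) \<and> (\<forall>i\<in>{1..k}. G i \<in> A i)"
      unfolding set_sum_alt[OF finite_atLeastAtMost] by (rule CollectD)
    then obtain G where FG: "F m = (\<Sum>i=1..k. G i)" and G: "\<And>i. i \<in> {1..k} \<Longrightarrow> G i \<in> A i"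
      by blast
    have zero: "coeff (coord (G i) 0) (d m) = 0" if "i \<in> {1..k}" for i
      using submodule_coord_degree_bound[OF assms, of "A i" "F i" "G i" "d m"]
        A[OF that] F[OF that] G[OF that] max[OF that] unfolding d_def by blast
    have "lead_coeff (coord (F m) 0) = coeff (coord (F m) 0) (d m)"
      by (simp add: d_def)
    also have "\<dots> = (\<Sum>i=1..k. coeff (coord (G i) 0) (d m))"
      by (simp add: FG coord_def coeff_sum)
    also have "\<dots> = 0" using zero by simp
    finally have "coord (F m) 0 = 0" by simp
    then have "F m = 0" using assms F[OF m(1)] unfolding L_module_def by (metis less_one)
    moreover have "0 \<in> A m" using A[OF m(1)] by (simp add: xy_module_def xy.subspace_0)
    ultimately show False using F[OF m(1)] by simp
  qed
  then show ?thesis using assms by (simp add: indecomposable_def L_module_def)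
qed

end
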